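(* For every monoid $M$, every oriented graph $G=(V,E)$ and every labeling $l:E\to M$, the Core Algorithm run on the diagram $(G,l)$ verifies its commutativity: it exits with value True if and only if $(G,l)$ is commutative (and exits with value False otherwise).
   Context: An oriented graph $G=(V,E)$ is a pair of finite nonempty sets (vertices and edges) with functions $t,o:E\to V$ giving the tail (end point) $t(e)$ and origin (starting point) $o(e)$ of each edge; loops and multiple edges are allowed. A diagram $(G,l)$ over a monoid $M$ is an oriented graph with a labeling $l:E\to M$. A path $p$ is a (possibly empty) edge sequence $(e_1,\dots,e_k)$ with $t(e_i)=o(e_{i+1})$ for all $i<k$, together with vertices $o(p),t(p)$ with $o(p)=o(e_1)$, $t(p)=t(e_k)$ if $k>0$ and $o(p)=t(p)$ if $k=0$; $l(p)=l(e_1)\cdots l(e_k)$, and $l(p)=\mathbf 1_M$ if $k=0$. The diagram is commutative if $l(p_1)=l(p_2)$ for all paths $p_1,p_2$ with $o(p_1)=o(p_2)$, $t(p_1)=t(p_2)$. Core Algorithm (input: a diagram $(G,l)$ over $M$; "exit" terminates the whole algorithm): 1. RemoveLoops: for each vertex $v$ and each edge $e$ with $o(e)=v$: if $t(e)=v$, then exit with False if $l(e)\ne\mathbf 1_M$, and otherwise remove $e$ from $G$. 2. RemoveMultipleEdges: for each vertex $v$: create an empty array $T$ indexed by $V$; for each remaining edge $e$ with $o(e)=v$: if $T[t(e)]$ is empty, set $T[t(e)]=l(e)$; otherwise exit with False if $l(e)\neq T[t(e)]$, and else remove $e$ from $G$. 3. For each vertex $v\in V$: mark all vertices as not visited, set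 $m(w)=\mathbf 1_M$ for all $w\in V$, and run DFS$(G,v)$. 4. Exit with True. DFS$(G,v)$: mark $v$ as visited; for each remaining edge $e$ with $o(e)=v$, let $u=t(e)$; if $u$ is not visited, call ProceedNewVertex$(v,e,u)$ and then DFS$(G,u)$; otherwise call ProceedOldVertex$(v,e,u)$. ProceedNewVertex$(v,e,u)$: set $m(u)=m(v)l(e)$. ProceedOldVertex$(v,e,u)$: if $m(u)\ne m(v)l(e)$, exit with False. *)

theory Defs
  imports
    "Graph_Theory.Arc_Walk"
    "HOL-Algebra.Group"
    "HOL-Combinatorics.Multiset_Permutations"
begin

section \<open>Diagrams over a monoid\<close>

text \<open>
  Pitfall: in the graph library the starting point \<open>o(e)\<close> of an edge is \<^const>\<open>tail\<close> and its
  end point \<open>t(e)\<close> is \<^const>\<open>head\<close>. So \<open>o(e) = tail G e\<close> and \<open>t(e) = head G e\<close>, although the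
  mathematical source calls \<open>t(e)\<close> the tail of \<open>e\<close>.
\<close>

definition oriented_graph :: "('v, 'e) pre_digraph \<Rightarrow> bool" where
  "oriented_graph G \<longleftrightarrow> fin_digraph G \<and> verts G \<noteq> {} \<and> arcs G \<noteq> {}"

definition path_label :: "('m, 'x) monoid_scheme \<Rightarrow> ('e \<Rightarrow> 'm) \<Rightarrow> 'e list \<Rightarrow> 'm" where
  "path_label M l p = foldr (\<otimes>\<^bsub>M\<^esub>) (map l p) \<one>\<^bsub>M\<^esub>"

text \<open>
  \<^term>\<open>pre_digraph.awalk G u p v\<close> says that the edge sequence \<open>p\<close> is a path with \<open>o(p) = u\<close> and
  \<open>t(p) = v\<close>; vertices and edges may be repeated, and \<open>p\<close> may be empty if \<open>u = v\<close>.
\<close>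

definition commutative_diagram ::
  "('m, 'x) monoid_scheme \<Rightarrow> ('v, 'e) pre_digraph \<Rightarrow> ('e \<Rightarrow> 'm) \<Rightarrow> bool" where
  "commutative_diagram M G l \<longleftrightarrow>
     (\<forall>u v p q. pre_digraph.awalk G u p v \<and> pre_digraph.awalk G u q v \<longrightarrow>
        path_label M l p = path_label M l q)"


section \<open>Programs that may exit, continue or diverge\<close>

text \<open>
  A computation has type \<open>'s outcome option\<close>: \<open>None\<close> is nontermination, \<open>Some (Exit b)\<close>
  terminates the whole algorithm with value \<open>b\<close>, and \<open>Some (Continue s)\<close> ends normally in
  the state \<open>s\<close>.
\<close>

datatype 's outcome = Exit bool | Continue 's

definition and_then ::
  "'s outcome option \<Rightarrow> ('s \<Rightarrow> 't outcome option) \<Rightarrow> 't outcome option"  (infixl "\<then>" 54) where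
  "c \<then> f = Option.bind c (\<lambda>r. case r of Exit b \<Rightarrow> Some (Exit b) | Continue s \<Rightarrow> f s)"

primrec for_each ::
  "'a list \<Rightarrow> ('a \<Rightarrow> 's \<Rightarrow> 's outcome option) \<Rightarrow> 's \<Rightarrow> 's outcome option" where
  "for_each [] body s = Some (Continue s)"
| "for_each (x # xs) body s = body x s \<then> for_each xs body"

lemma and_then_mono [partial_function_mono]:
  assumes "mono_option B" and "\<And>s. mono_option (\<lambda>f. C s f)"
  shows "mono_option (\<lambda>f. B f \<then> (\<lambda>s. C s f))"
  unfolding and_then_def
proof (rule bind_mono[OF assms(1)])
  fix r
  show "mono_option (\<lambda>f. case r of Exit b \<Rightarrow> Some (Exit b) | Continue s \<Rightarrow> C s f)"
    using assms(2) by (cases r) (auto intro: option.const_mono)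
qed

lemma for_each_mono [partial_function_mono]:
  assumes "\<And>x s. mono_option (\<lambda>f. B x s f)"
  shows "mono_option (\<lambda>f. for_each xs (\<lambda>x s. B x s f) s)"
proof (induction xs arbitrary: s)
  case Nil
  show ?case by (simp add: option.const_mono)
next
  case (Cons x xs)
  show ?case
    by (simp, rule and_then_mono[of "B x s" "\<lambda>s f. for_each xs (\<lambda>x s. B x s f) s"])
      (fact assms, fact Cons.IH)
qed


section \<open>The Core Algorithm\<close>

text \<open>
  The order in which the loops enumerate vertices and edges is unspecified, so it is a
  parameter. The edge orders enumerate all edges of the input graph that start at \<open>v\<close>, and the
  loops skip those already removed. The order of the edges in the depth-first search may also
  depend on the root \<open>r\<close>. As each edge loop is entered at most once per vertex (and per root, in
  the search), every possible run is obtained from some orders of this kind.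
\<close>

record ('v, 'e) loop_orders =
  vs_loops :: "'v list"
  es_loops :: "'v \<Rightarrow> 'e list"
  vs_multi :: "'v list"
  es_multi :: "'v \<Rightarrow> 'e list"
  roots :: "'v list"
  es_dfs :: "'v \<Rightarrow> 'v \<Rightarrow> 'e list"

definition loop_orders_of :: "('v, 'e) pre_digraph \<Rightarrow> ('v, 'e) loop_orders \<Rightarrow> bool" where
  "loop_orders_of G ord \<longleftrightarrow>
     vs_loops ord \<in> permutations_of_set (verts G) \<and>
     vs_multi ord \<in> permutations_of_set (verts G) \<and>
     roots ord \<in> permutations_of_set (verts G) \<and>
     (\<forall>v\<in>verts G.
        es_loops ord v \<in> permutations_of_set (out_arcs G v) \<and>
        es_multi ord v \<in> permutations_of_set (out_arcs G v) \<and>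
        (\<forall>r\<in>verts G. es_dfs ord r v \<in> permutations_of_set (out_arcs G v)))"

definition remaining :: "('v, 'e) pre_digraph \<Rightarrow> 'e list \<Rightarrow> 'e list" where
  "remaining G es = filter (\<lambda>e. e \<in> arcs G) es"

definition remove_loops ::
  "('m, 'x) monoid_scheme \<Rightarrow> ('e \<Rightarrow> 'm) \<Rightarrow> ('v, 'e) loop_orders \<Rightarrow>
   ('v, 'e) pre_digraph \<Rightarrow> ('v, 'e) pre_digraph outcome option" where
  "remove_loops M l ord =
     for_each (vs_loops ord) (\<lambda>v G.
       for_each (remaining G (es_loops ord v)) (\<lambda>e G.
         if head G e = v then
           if l e \<noteq> \<one>\<^bsub>M\<^esub> then Some (Exit False)
           else Some (Continue (pre_digraph.del_arc G e))
         else Some (Continue G)) G)"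

text \<open>The state of the inner loop is the array \<open>T\<close> together with the current graph.\<close>

definition remove_multiple_edges ::
  "('e \<Rightarrow> 'm) \<Rightarrow> ('v, 'e) loop_orders \<Rightarrow>
   ('v, 'e) pre_digraph \<Rightarrow> ('v, 'e) pre_digraph outcome option" where
  "remove_multiple_edges l ord =
     for_each (vs_multi ord) (\<lambda>v G.
       for_each (remaining G (es_multi ord v)) (\<lambda>e (T, G).
         case T (head G e) of
           None \<Rightarrow> Some (Continue (T(head G e \<mapsto> l e), G))
         | Some a \<Rightarrow>
             if l e \<noteq> a then Some (Exit False)
             else Some (Continue (T, pre_digraph.del_arc G e)))
         (Map.empty, G)
       \<then> (\<lambda>(T, G). Some (Continue G)))"

record ('v, 'm) dfs_state =
  visited :: "'v set"
  mval :: "'v \<Rightarrow> 'm"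

definition proceed_new_vertex ::
  "('m, 'x) monoid_scheme \<Rightarrow> ('e \<Rightarrow> 'm) \<Rightarrow> 'v \<Rightarrow> 'e \<Rightarrow> 'v \<Rightarrow>
   ('v, 'm) dfs_state \<Rightarrow> ('v, 'm) dfs_state outcome option" where
  "proceed_new_vertex M l v e u s =
     Some (Continue (s\<lparr>mval := (mval s)(u := mval s v \<otimes>\<^bsub>M\<^esub> l e)\<rparr>))"

definition proceed_old_vertex ::
  "('m, 'x) monoid_scheme \<Rightarrow> ('e \<Rightarrow> 'm) \<Rightarrow> 'v \<Rightarrow> 'e \<Rightarrow> 'v \<Rightarrow>
   ('v, 'm) dfs_state \<Rightarrow> ('v, 'm) dfs_state outcome option" where
  "proceed_old_vertex M l v e u s =
     (if mval s u \<noteq> mval s v \<otimes>\<^bsub>M\<^esub> l e then Some (Exit False) else Some (Continue s))"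

partial_function (option) dfs ::
  "('m, 'x) monoid_scheme \<Rightarrow> ('e \<Rightarrow> 'm) \<Rightarrow> ('v \<Rightarrow> 'e list) \<Rightarrow> ('v, 'e) pre_digraph \<Rightarrow> 'v \<Rightarrow>
   ('v, 'm) dfs_state \<Rightarrow> ('v, 'm) dfs_state outcome option" where
  "dfs M l out G v s =
     for_each (remaining G (out v)) (\<lambda>e s.
       let u = head G e in
         if u \<notin> visited s then proceed_new_vertex M l v e u s \<then> (\<lambda>s. dfs M l out G u s)
         else proceed_old_vertex M l v e u s)
       (s\<lparr>visited := insert v (visited s)\<rparr>)"

definition search_from_all_roots ::
  "('m, 'x) monoid_scheme \<Rightarrow> ('e \<Rightarrow> 'm) \<Rightarrow> ('v, 'e) loop_orders \<Rightarrow>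
   ('v, 'e) pre_digraph \<Rightarrow> unit outcome option" where
  "search_from_all_roots M l ord G =
     for_each (roots ord) (\<lambda>r _.
       dfs M l (es_dfs ord r) G r \<lparr>visited = {}, mval = (\<lambda>_. \<one>\<^bsub>M\<^esub>)\<rparr>
       \<then> (\<lambda>_. Some (Continue ()))) ()"

definition core_algorithm ::
  "('m, 'x) monoid_scheme \<Rightarrow> ('v, 'e) loop_orders \<Rightarrow> ('v, 'e) pre_digraph \<Rightarrow> ('e \<Rightarrow> 'm) \<Rightarrow>
   unit outcome option" where
  "core_algorithm M ord G l =
     remove_loops M l ord G
     \<then> remove_multiple_edges l ord
     \<then> search_from_all_roots M l ord
     \<then> (\<lambda>_. Some (Exit True))"

end

theory Submission
  imports Defs
begin

text \<open>
  The algorithm is a sequence of steps which either exit with \<open>False\<close> or continue, so it suffices to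
  show that it terminates, that every exit with \<open>False\<close> is justified by a pair of paths with the same
  ends and different labels, and that reaching the final step forces commutativity. The predicate
  \<open>ends_with\<close> packages these three claims for one computation, and its rules for sequencing and for
  loops with an invariant turn the correctness proof into the choice of invariants.

  Removing edges is harmless because the removed edge can always be bypassed: a loop labeled \<open>\<one>\<close> by
  the empty path, a repeated edge by the earlier edge with the same ends and the same label. Hence
  every path of the original graph has a counterpart with the same ends and label in the
  smaller graph (\<open>reduces_to\<close>), and the two diagrams are commutative simultaneously.

  In the search from a root \<open>r\<close>, the value \<open>m(w)\<close> at each visited \<open>w\<close> is the label of some path from
  \<open>r\<close> to \<open>w\<close>. So a failed comparison \<open>m(u) \<noteq> m(v) l(e)\<close> exhibits two paths from \<open>r\<close> to \<open>u\<close> with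
  different labels. Conversely, when the search ends, every edge \<open>e\<close> that leaves a visited vertex
  satisfies \<open>m(t(e)) = m(o(e)) l(e)\<close>: the equation was established or checked when \<open>e\<close> was examined,
  and it persists because the value at a visited vertex never changes. By induction along paths,
  \<open>m(w)\<close> is then the label of every path from \<open>r\<close> to \<open>w\<close> (lemmas \<open>dfs_spec\<close> and
  \<open>walk_label_eq_mval\<close>). Using all vertices as roots covers all pairs of paths. The search terminates
  because each recursive call visits a new vertex.
\<close>


section \<open>Reasoning about computations that may exit with False\<close>

definition ends_with :: "bool \<Rightarrow> ('s \<Rightarrow> bool) \<Rightarrow> 's outcome option \<Rightarrow> bool" where
  "ends_with bad Q c \<longleftrightarrow> c = Some (Exit False) \<and> bad \<or> (\<exists>s. c = Some (Continue s) \<and> Q s)"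

lemma ends_with_Continue [simp]: "ends_with bad Q (Some (Continue s)) \<longleftrightarrow> Q s"
  by (simp add: ends_with_def)

lemma ends_with_Exit_False [simp]: "ends_with bad Q (Some (Exit False)) \<longleftrightarrow> bad"
  by (simp add: ends_with_def)

lemma ends_with_mono:
  assumes "ends_with bad Q c" and "\<And>s. Q s \<Longrightarrow> R s"
  shows "ends_with bad R c"
  using assms by (auto simp: ends_with_def)

lemma ends_with_and_then:
  assumes "ends_with bad Q c" and "\<And>s. Q s \<Longrightarrow> ends_with bad R (f s)"
  shows "ends_with bad R (c \<then> f)"
  using assms unfolding ends_with_def and_then_def by fastforce

text \<open>
  The invariant depends on the list of elements treated so far, which the searches need in order to
  say that the edges already examined have been found consistent.
\<close>

lemma ends_with_for_each:
  assumes "I [] s"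
    and "\<And>pre x post s. xs = pre @ x # post \<Longrightarrow> I pre s \<Longrightarrow> ends_with bad (I (pre @ [x])) (body x s)"
  shows "ends_with bad (I xs) (for_each xs body s)"
proof -
  have "ends_with bad (I xs) (for_each post body s)" if "xs = pre @ post" "I pre s" for pre post s
    using that
  proof (induction post arbitrary: pre s)
    case Nil
    then show ?case by simp
  next
    case (Cons x post)
    have "ends_with bad (I (pre @ [x])) (body x s)"
      using assms(2) Cons.prems by blast
    then show ?case
      using Cons.IH[of "pre @ [x]"] Cons.prems(1) by (auto intro: ends_with_and_then)
  qed
  from this[of "[]" xs s] assms(1) show ?thesis by simp
qed

lemma ends_with_for_each_const:
  assumes "I s" and "\<And>x s. x \<in> set xs \<Longrightarrow> I s \<Longrightarrow> ends_with bad I (body x s)"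
  shows "ends_with bad I (for_each xs body s)"
  using assms by (intro ends_with_for_each[where I = "\<lambda>_. I"]) auto


section \<open>Labels of paths\<close>

locale diagram = wf_digraph G + monoid M
  for G :: "('v, 'e) pre_digraph" and M :: "('m, 'x) monoid_scheme" (structure) +
  fixes l :: "'e \<Rightarrow> 'm"
  assumes labels_closed: "l \<in> arcs G \<rightarrow> carrier M"
begin

lemma path_label_Nil [simp]: "path_label M l [] = \<one>"
  by (simp add: path_label_def)

lemma path_label_Cons [simp]: "path_label M l (e # p) = l e \<otimes> path_label M l p"
  by (simp add: path_label_def)

lemma label_closed [simp]: "e \<in> arcs G \<Longrightarrow> l e \<in> carrier M"
  using labels_closed by auto

lemma path_label_closed: "set p \<subseteq> arcs G \<Longrightarrow> path_label M l p \<in> carrier M"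
  by (induction p) auto

lemma awalk_label_closed: "awalk u p v \<Longrightarrow> path_label M l p \<in> carrier M"
  by (simp add: awalk_def path_label_closed)

lemma path_label_append:
  assumes "set p \<subseteq> arcs G" and "set q \<subseteq> arcs G"
  shows "path_label M l (p @ q) = path_label M l p \<otimes> path_label M l q"
  using assms by (induction p) (auto simp: path_label_closed m_assoc)

lemma awalk_snoc_label:
  assumes "awalk u p v" and "e \<in> out_arcs G v"
  shows "awalk u (p @ [e]) (head G e)"
    and "path_label M l (p @ [e]) = path_label M l p \<otimes> l e"
proof -
  have e: "e \<in> arcs G" "tail G e = v" using assms(2) by auto
  show "awalk u (p @ [e]) (head G e)"
    using assms(1) arc_implies_awalk[OF e(1)] e(2) by (auto intro: awalk_appendI)
  show "path_label M l (p @ [e]) = path_label M l p \<otimes> l e"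
    using assms(1) e(1) by (simp add: awalk_def path_label_append)
qed

lemma arc_not_commutative:
  assumes "e \<in> arcs G" "awalk (tail G e) q (head G e)" "path_label M l q \<noteq> l e"
  shows "\<not> commutative_diagram M G l"
proof -
  have "path_label M l [e] = l e" using assms(1) by simp
  then show ?thesis
    using assms arc_implies_awalk[OF assms(1)] unfolding commutative_diagram_def by metis
qed

end


section \<open>Removal of edges that can be bypassed\<close>

definition reduces_to ::
  "('m, 'x) monoid_scheme \<Rightarrow> ('e \<Rightarrow> 'm) \<Rightarrow> ('v, 'e) pre_digraph \<Rightarrow> ('v, 'e) pre_digraph \<Rightarrow> bool"
  where
  "reduces_to M l G H \<longleftrightarrow>
     verts H = verts G \<and> arcs H \<subseteq> arcs G \<and> tail H = tail G \<and> head H = head G \<and>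
     (\<forall>u p v. pre_digraph.awalk G u p v \<longrightarrow>
        (\<exists>q. pre_digraph.awalk H u q v \<and> path_label M l q = path_label M l p))"

lemma reduces_to_refl: "reduces_to M l G G"
  unfolding reduces_to_def by blast

lemma reduces_to_trans:
  assumes "reduces_to M l G H" and "reduces_to M l H K"
  shows "reduces_to M l G K"
  using assms unfolding reduces_to_def by (metis order_trans)

lemma awalk_subgraph:
  assumes "pre_digraph.awalk H u p v"
    and "verts H = verts G" "arcs H \<subseteq> arcs G" "tail H = tail G" "head H = head G"
  shows "pre_digraph.awalk G u p v"
proof -
  have "pre_digraph.cas H u p v = pre_digraph.cas G u p v" for u
    using assms(4,5) by (induction p arbitrary: u) (simp_all add: pre_digraph.cas.simps)
  then show ?thesis
    using assms by (auto simp: pre_digraph.awalk_def)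
qed

lemma reduces_to_commutative_iff:
  assumes "reduces_to M l G H"
  shows "commutative_diagram M H l \<longleftrightarrow> commutative_diagram M G l"
proof
  assume "commutative_diagram M H l"
  then show "commutative_diagram M G l"
    using assms unfolding reduces_to_def commutative_diagram_def by metis
next
  have "pre_digraph.awalk G u p v" if "pre_digraph.awalk H u p v" for u p v
    using awalk_subgraph[OF that] assms by (simp add: reduces_to_def)
  then show "commutative_diagram M G l \<Longrightarrow> commutative_diagram M H l"
    unfolding commutative_diagram_def by blast
qed

lemma (in diagram) reduces_to_diagram:
  assumes "reduces_to M l G H"
  shows "diagram H M l"
proof unfold_locales
qed (use assms labels_closed in \<open>auto simp: reduces_to_def\<close>)

text \<open>
  Each occurrence of \<open>e\<close> in a path is replaced by the bypass \<open>q\<close>.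
\<close>

lemma (in diagram) reduces_to_del_arc:
  assumes bypass: "awalk (tail G e) q (head G e)" "e \<notin> set q" "path_label M l q = l e"
  shows "reduces_to M l G (del_arc e)"
proof -
  interpret H: wf_digraph "del_arc e"
    by (rule wf_digraph_del_arc)
  have keep: "H.awalk u p v" if "awalk u p v" "e \<notin> set p" for u p v
    using that by (induction p arbitrary: u)
      (auto simp: awalk_Cons_iff H.awalk_Cons_iff awalk_Nil_iff H.awalk_Nil_iff)
  have "\<exists>p'. H.awalk u p' v \<and> path_label M l p' = path_label M l p" if "awalk u p v" for u p v
    using that
  proof (induction p arbitrary: u)
    case Nil
    then show ?case using keep[of u "[]" v] by auto
  next
    case (Cons a p)
    then have a: "a \<in> arcs G" "tail G a = u" and "awalk (head G a) p v"
      by (auto simp: awalk_Cons_iff)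
    then obtain p' where p': "H.awalk (head G a) p' v" "path_label M l p' = path_label M l p"
      using Cons.IH by blast
    obtain b where b: "H.awalk u b (head G a)" "path_label M l b = l a"
    proof (cases "a = e")
      case True
      then show ?thesis using that keep[OF bypass(1,2)] bypass(3) a(2) by simp
    next
      case False
      then show ?thesis using that[of "[a]"] keep[OF arc_implies_awalk[OF a(1)]] a by simp
    qed
    have "set b \<subseteq> arcs G" "set p' \<subseteq> arcs G"
      using b(1) p'(1) by (auto simp: H.awalk_def)
    then have "path_label M l (b @ p') = path_label M l (a # p)"
      using b(2) p'(2) by (simp add: path_label_append)
    moreover have "H.awalk u (b @ p') v"
      using b(1) p'(1) by (rule H.awalk_appendI)
    ultimately show ?case by blast
  qed
  then show ?thesis by (auto simp: reduces_to_def)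
qed

context diagram
begin

lemma remove_loops_spec:
  assumes "loop_orders_of G ord"
  shows "ends_with (\<not> commutative_diagram M G l) (reduces_to M l G) (remove_loops M l ord G)"
  unfolding remove_loops_def
proof (intro ends_with_for_each_const reduces_to_refl)
  fix v H\<^sub>0 e H
  assume "v \<in> set (vs_loops ord)" and e: "e \<in> set (remaining H\<^sub>0 (es_loops ord v))"
    and red: "reduces_to M l G H"
  then have v: "v \<in> verts G" and e_out: "e \<in> out_arcs G v"
    using assms by (auto simp: loop_orders_of_def permutations_of_set_def remaining_def)
  interpret H: diagram H M l using red by (rule reduces_to_diagram)
  have H: "verts H = verts G" "tail H = tail G" "head H = head G"
    using red by (simp_all add: reduces_to_def)
  show "ends_with (\<not> commutative_diagram M G l) (reduces_to M l G)
    (if head H e = v then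
       if l e \<noteq> \<one> then Some (Exit False) else Some (Continue (pre_digraph.del_arc H e))
     else Some (Continue H))"
  proof (cases "head H e = v")
    case True
    have nil: "awalk (tail G e) [] (head G e)"
      using True v e_out H by (simp add: awalk_Nil_iff)
    have "\<not> commutative_diagram M G l" if "l e \<noteq> \<one>"
      using arc_not_commutative[OF _ nil] e_out that by auto
    moreover have "reduces_to M l H (H.del_arc e)" if "l e = \<one>"
      using True v e_out H that by (intro H.reduces_to_del_arc[of e "[]"]) (auto simp: H.awalk_Nil_iff)
    ultimately show ?thesis
      using True red by (auto intro: reduces_to_trans)
  next
    case False
    then show ?thesis using red by simp
  qed
qed

text \<open>
  The table entry for \<open>u\<close> comes from an edge to \<open>u\<close> that was examined before the current edge \<open>e\<close> and
  is kept. As the edges are enumerated without repetition, it differs from \<open>e\<close>, and so it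
  survives the removal of \<open>e\<close>.
\<close>

lemma remove_multiple_edges_inner:
  assumes es: "distinct es" "set es \<subseteq> out_arcs G v" "set es \<subseteq> arcs H" and red: "reduces_to M l G H"
  shows "ends_with (\<not> commutative_diagram M G l) (\<lambda>(T, H). reduces_to M l G H)
    (for_each es (\<lambda>e (T, G).
         case T (head G e) of
           None \<Rightarrow> Some (Continue (T(head G e \<mapsto> l e), G))
         | Some a \<Rightarrow>
             if l e \<noteq> a then Some (Exit False)
             else Some (Continue (T, pre_digraph.del_arc G e)))
         (Map.empty, H))"
proof -
  define I where "I pre = (\<lambda>(T :: 'v \<Rightarrow> 'm option, H). reduces_to M l G H \<and> set es - set pre \<subseteq> arcs H \<and>
    (\<forall>u a. T u = Some a \<longrightarrow>
       (\<exists>e'\<in>set pre \<inter> arcs H. tail G e' = v \<and> head G e' = u \<and> l e' = a)))" for pre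
  let ?bad = "\<not> commutative_diagram M G l"
  have "ends_with ?bad (I es) (for_each es (\<lambda>e (T, G).
         case T (head G e) of
           None \<Rightarrow> Some (Continue (T(head G e \<mapsto> l e), G))
         | Some a \<Rightarrow>
             if l e \<noteq> a then Some (Exit False)
             else Some (Continue (T, pre_digraph.del_arc G e)))
         (Map.empty, H))"
  proof (rule ends_with_for_each)
    show "I [] (Map.empty, H)" using es red by (simp add: I_def)
  next
    fix pre e post and s :: "('v \<Rightarrow> 'm option) \<times> ('v, 'e) pre_digraph"
    assume split: "es = pre @ e # post" and "I pre s"
    obtain T H where s: "s = (T, H)" by (cases s)
    have red: "reduces_to M l G H" and rest: "set es - set pre \<subseteq> arcs H"
      and T: "\<And>u a. T u = Some a \<Longrightarrow>
        \<exists>e'\<in>set pre \<inter> arcs H. tail G e' = v \<and> head G e' = u \<and> l e' = a"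
      using \<open>I pre s\<close> by (auto simp: I_def s)
    interpret H: diagram H M l using red by (rule reduces_to_diagram)
    have H: "tail H = tail G" "head H = head G"
      using red by (simp_all add: reduces_to_def)
    have e: "e \<notin> set pre" "e \<in> arcs G" "tail G e = v" "e \<in> arcs H"
      using es split rest by auto
    show "ends_with ?bad (I (pre @ [e])) ((\<lambda>(T, G).
         case T (head G e) of
           None \<Rightarrow> Some (Continue (T(head G e \<mapsto> l e), G))
         | Some a \<Rightarrow>
             if l e \<noteq> a then Some (Exit False)
             else Some (Continue (T, pre_digraph.del_arc G e))) s)"
    proof (cases "T (head G e)")
      case None
      have "I (pre @ [e]) (T(head G e \<mapsto> l e), H)"
        using red rest T e by (auto simp: I_def)
      then show ?thesis using None by (simp add: s H)
    next
      case (Some a)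
      then obtain e' where e': "e' \<in> set pre" "e' \<in> arcs H" "tail G e' = v"
          "head G e' = head G e" "l e' = a"
        using T by blast
      have e'G: "e' \<in> arcs G" using e'(2) red by (auto simp: reduces_to_def)
      show ?thesis
      proof (cases "l e = a")
        case True
        have "reduces_to M l H (H.del_arc e)"
        proof (rule H.reduces_to_del_arc[of e "[e']"])
          show "H.awalk (tail H e) [e'] (head H e)"
            using H.arc_implies_awalk[OF e'(2)] e' e by (simp add: H)
        qed (use e' e True in auto)
        then have "reduces_to M l G (H.del_arc e)"
          using red by (rule reduces_to_trans[rotated])
        moreover have "\<exists>e'\<in>set (pre @ [e]) \<inter> arcs (H.del_arc e).
            tail G e' = v \<and> head G e' = u \<and> l e' = b" if "T u = Some b" for u b
          using T[OF that] e(1) by fastforce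
        ultimately have "I (pre @ [e]) (T, H.del_arc e)"
          using rest by (auto simp: I_def)
        then show ?thesis using Some True by (simp add: s H)
      next
        case False
        have "?bad"
        proof (rule arc_not_commutative)
          show "awalk (tail G e) [e'] (head G e)"
            using arc_implies_awalk[OF e'G] e' e by simp
          show "path_label M l [e'] \<noteq> l e" using label_closed[OF e'G] e'(5) False by auto
        qed (fact e(2))
        then show ?thesis using Some False by (simp add: s H)
      qed
    qed
  qed
  then show ?thesis by (rule ends_with_mono) (auto simp: I_def)
qed

lemma remove_multiple_edges_spec:
  assumes "loop_orders_of G ord" and "reduces_to M l G H"
  shows "ends_with (\<not> commutative_diagram M G l) (reduces_to M l G)
    (remove_multiple_edges l ord H)"
  unfolding remove_multiple_edges_def
proof (intro ends_with_for_each_const assms(2))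
  fix v H
  assume "v \<in> set (vs_multi ord)" and red: "reduces_to M l G H"
  then have "es_multi ord v \<in> permutations_of_set (out_arcs G v)"
    using assms(1) by (auto simp: loop_orders_of_def permutations_of_set_def)
  then have es: "distinct (remaining H (es_multi ord v))"
      "set (remaining H (es_multi ord v)) \<subseteq> out_arcs G v"
      "set (remaining H (es_multi ord v)) \<subseteq> arcs H"
    by (simp_all add: permutations_of_set_def remaining_def subset_eq)
  show "ends_with (\<not> commutative_diagram M G l) (reduces_to M l G)
    (for_each (remaining H (es_multi ord v)) (\<lambda>e (T, G).
         case T (head G e) of
           None \<Rightarrow> Some (Continue (T(head G e \<mapsto> l e), G))
         | Some a \<Rightarrow>
             if l e \<noteq> a then Some (Exit False)
             else Some (Continue (T, pre_digraph.del_arc G e)))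
         (Map.empty, H)
     \<then> (\<lambda>(T, G). Some (Continue G)))"
    by (rule ends_with_and_then[OF remove_multiple_edges_inner[OF es red]])
      (simp split: prod.splits)
qed

end


section \<open>Depth-first search\<close>

context diagram
begin

definition extends :: "('v, 'm) dfs_state \<Rightarrow> ('v, 'm) dfs_state \<Rightarrow> bool" where
  "extends s s' \<longleftrightarrow> visited s \<subseteq> visited s' \<and> (\<forall>w\<in>visited s. mval s' w = mval s w)"

definition values_realized :: "'v \<Rightarrow> ('v, 'm) dfs_state \<Rightarrow> bool" where
  "values_realized r s \<longleftrightarrow>
     (\<forall>w\<in>visited s. \<exists>p. awalk r p w \<and> path_label M l p = mval s w)"

definition consistent :: "('v, 'm) dfs_state \<Rightarrow> 'e \<Rightarrow> bool" where
  "consistent s e \<longleftrightarrow>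
     head G e \<in> visited s \<and> mval s (head G e) = mval s (tail G e) \<otimes> l e"

lemma extends_refl: "extends s s"
  by (simp add: extends_def)

lemma extends_trans: "extends s s' \<Longrightarrow> extends s' s'' \<Longrightarrow> extends s s''"
  by (auto simp: extends_def)

lemma consistent_extends:
  "consistent s e \<Longrightarrow> extends s s' \<Longrightarrow> tail G e \<in> visited s \<Longrightarrow> consistent s' e"
  by (auto simp: consistent_def extends_def)

lemma values_realized_in_verts: "values_realized r s \<Longrightarrow> visited s \<subseteq> verts G"
  unfolding values_realized_def by (auto dest: awalk_last_in_verts)

text \<open>
  The call for \<open>v\<close> is responsible only for the vertices that it visits itself. The vertices on the
  current search path are visited but still have unexamined edges, and so consistency cannot be
  claimed for all visited vertices until the outermost call returns.
\<close>

lemma dfs_spec: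
  assumes fin: "finite (verts G)"
    and out: "\<And>v. v \<in> verts G \<Longrightarrow> set (remaining G (out v)) = out_arcs G v"
    and "v \<notin> visited s"
    and "values_realized r (s\<lparr>visited := insert v (visited s)\<rparr>)"
  shows "ends_with (\<not> commutative_diagram M G l)
    (\<lambda>s'. extends (s\<lparr>visited := insert v (visited s)\<rparr>) s' \<and> values_realized r s' \<and>
       (\<forall>w\<in>visited s' - visited s. \<forall>e\<in>out_arcs G w. consistent s' e))
    (dfs M l out G v s)"
  using assms(3,4)
proof (induction "card (verts G - visited s)" arbitrary: v s rule: less_induct)
  case less
  define s\<^sub>0 where "s\<^sub>0 = s\<lparr>visited := insert v (visited s)\<rparr>"
  have s\<^sub>0: "visited s\<^sub>0 = insert v (visited s)" by (simp add: s\<^sub>0_def)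
  have v: "v \<in> verts G"
    using values_realized_in_verts[OF less.prems(2)] by simp
  let ?bad = "\<not> commutative_diagram M G l"
  let ?es = "remaining G (out v)"
  let ?body = "\<lambda>e s. let u = head G e in
         if u \<notin> visited s then proceed_new_vertex M l v e u s \<then> (\<lambda>s. dfs M l out G u s)
         else proceed_old_vertex M l v e u s"
  define I where "I pre s\<^sub>1 \<longleftrightarrow> extends s\<^sub>0 s\<^sub>1 \<and> values_realized r s\<^sub>1 \<and>
      (\<forall>w\<in>visited s\<^sub>1 - visited s\<^sub>0. \<forall>e\<in>out_arcs G w. consistent s\<^sub>1 e) \<and>
      (\<forall>e\<in>set pre. consistent s\<^sub>1 e)" for pre s\<^sub>1
  have "ends_with ?bad (I ?es) (for_each ?es ?body s\<^sub>0)"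
  proof (rule ends_with_for_each)
    show "I [] s\<^sub>0"
      using less.prems(2) by (simp add: I_def extends_refl s\<^sub>0_def)
  next
    fix pre e post s\<^sub>1
    assume split: "?es = pre @ e # post" and I: "I pre s\<^sub>1"
    have e: "e \<in> out_arcs G v" and pre: "set pre \<subseteq> out_arcs G v"
      using out[OF v] split by auto
    have ext: "extends s\<^sub>0 s\<^sub>1" and real: "values_realized r s\<^sub>1"
      and new: "\<And>w f. w \<in> visited s\<^sub>1 - visited s\<^sub>0 \<Longrightarrow> f \<in> out_arcs G w \<Longrightarrow> consistent s\<^sub>1 f"
      and old: "\<And>f. f \<in> set pre \<Longrightarrow> consistent s\<^sub>1 f"
      using I by (auto simp: I_def)
    have v1: "v \<in> visited s\<^sub>1" using ext by (auto simp: extends_def s\<^sub>0)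
    then obtain p where p: "awalk r p v" "path_label M l p = mval s\<^sub>1 v"
      using real by (auto simp: values_realized_def)
    have walk: "awalk r (p @ [e]) (head G e)"
        "path_label M l (p @ [e]) = mval s\<^sub>1 v \<otimes> l e"
      using awalk_snoc_label[OF p(1) e] p(2) by simp_all
    show "ends_with ?bad (I (pre @ [e])) (?body e s\<^sub>1)"
    proof (cases "head G e \<in> visited s\<^sub>1")
      case True
      then obtain q where q: "awalk r q (head G e)" "path_label M l q = mval s\<^sub>1 (head G e)"
        using real by (auto simp: values_realized_def)
      have ?bad if "mval s\<^sub>1 (head G e) \<noteq> mval s\<^sub>1 v \<otimes> l e"
        using walk q that unfolding commutative_diagram_def by metis
      moreover have "I (pre @ [e]) s\<^sub>1" if "mval s\<^sub>1 (head G e) = mval s\<^sub>1 v \<otimes> l e"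
        using I True that e by (simp add: I_def consistent_def)
      ultimately show ?thesis
        using True by (simp add: proceed_old_vertex_def)
    next
      case False
      define u where "u = head G e"
      define s\<^sub>2 where "s\<^sub>2 = s\<^sub>1\<lparr>mval := (mval s\<^sub>1)(u := mval s\<^sub>1 v \<otimes> l e)\<rparr>"
      have u: "u \<notin> visited s\<^sub>1" "u \<noteq> v" using False v1 by (auto simp: u_def)
      have ext2: "extends s\<^sub>1 (s\<^sub>2\<lparr>visited := insert u (visited s\<^sub>2)\<rparr>)"
        using u by (auto simp: extends_def s\<^sub>2_def)
      have "ends_with ?bad
          (\<lambda>s'. extends (s\<^sub>2\<lparr>visited := insert u (visited s\<^sub>2)\<rparr>) s' \<and> values_realized r s' \<and>
             (\<forall>w\<in>visited s' - visited s\<^sub>2. \<forall>e\<in>out_arcs G w. consistent s' e))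
          (dfs M l out G u s\<^sub>2)"
      proof (rule less.hyps)
        have "verts G - visited s\<^sub>2 \<subset> verts G - visited s"
          using ext v less.prems(1) v1 by (auto simp: extends_def s\<^sub>0 s\<^sub>2_def)
        then show "card (verts G - visited s\<^sub>2) < card (verts G - visited s)"
          using fin by (intro psubset_card_mono) auto
        show "u \<notin> visited s\<^sub>2" using u by (simp add: s\<^sub>2_def)
        show "values_realized r (s\<^sub>2\<lparr>visited := insert u (visited s\<^sub>2)\<rparr>)"
          using real walk by (auto simp: values_realized_def s\<^sub>2_def u_def simp del: awalk_append_iff)
      qed
      then have "ends_with ?bad (I (pre @ [e])) (dfs M l out G u s\<^sub>2)"
      proof (rule ends_with_mono, elim conjE)
        fix s\<^sub>3
        assume ext3: "extends (s\<^sub>2\<lparr>visited := insert u (visited s\<^sub>2)\<rparr>) s\<^sub>3"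
          and real3: "values_realized r s\<^sub>3"
          and new3: "\<forall>w\<in>visited s\<^sub>3 - visited s\<^sub>2. \<forall>e\<in>out_arcs G w. consistent s\<^sub>3 e"
        have ext13: "extends s\<^sub>1 s\<^sub>3" using ext2 ext3 by (rule extends_trans)
        have "consistent s\<^sub>3 f" if "w \<in> visited s\<^sub>3 - visited s\<^sub>0" "f \<in> out_arcs G w" for w f
        proof (cases "w \<in> visited s\<^sub>1")
          case True
          then show ?thesis
            using new[of w f] that consistent_extends[OF _ ext13] by auto
        next
          case False
          then show ?thesis using new3 that by (auto simp: s\<^sub>2_def)
        qed
        moreover have "consistent s\<^sub>3 f" if "f \<in> set pre" for f
          using old[OF that] consistent_extends[OF _ ext13] pre that v1 by auto
        moreover have "consistent s\<^sub>3 e"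
          using ext3 v1 u e by (auto simp: consistent_def extends_def s\<^sub>2_def u_def)
        ultimately show "I (pre @ [e]) s\<^sub>3"
          using extends_trans[OF ext ext13] real3 by (simp add: I_def)
      qed
      then show ?thesis
        using False by (simp add: Let_def proceed_new_vertex_def and_then_def s\<^sub>2_def u_def)
    qed
  qed
  then have "ends_with ?bad (I ?es) (dfs M l out G v s)"
    by (subst dfs.simps) (simp add: s\<^sub>0_def)
  then show ?case
    by (rule ends_with_mono) (use out[OF v] in \<open>auto simp: I_def s\<^sub>0 simp flip: s\<^sub>0_def\<close>)
qed

lemma walk_label_eq_mval:
  assumes "\<And>w e. w \<in> visited s \<Longrightarrow> e \<in> out_arcs G w \<Longrightarrow> consistent s e"
    and "awalk u p w" "u \<in> visited s" "mval s u \<in> carrier M"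
  shows "mval s w = mval s u \<otimes> path_label M l p"
  using assms(2-)
proof (induction p arbitrary: u)
  case Nil
  then show ?case by (simp add: awalk_Nil_iff)
next
  case (Cons e p)
  then have e: "e \<in> out_arcs G u" and p: "awalk (head G e) p w"
    by (auto simp: awalk_Cons_iff)
  then have c: "head G e \<in> visited s" "mval s (head G e) = mval s u \<otimes> l e"
    using assms(1)[OF Cons.prems(2) e] by (auto simp: consistent_def)
  have "mval s w = (mval s u \<otimes> l e) \<otimes> path_label M l p"
    using Cons.IH[OF p c(1)] c(2) e Cons.prems(3) by simp
  then show ?case
    using e Cons.prems(3) awalk_label_closed[OF p] by (simp add: m_assoc)
qed

lemma dfs_from_root_spec:
  assumes "finite (verts G)" "r \<in> verts G"
    and "\<And>v. v \<in> verts G \<Longrightarrow> set (remaining G (out v)) = out_arcs G v"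
  shows "ends_with (\<not> commutative_diagram M G l)
    (\<lambda>_. \<forall>w p q. awalk r p w \<and> awalk r q w \<longrightarrow> path_label M l p = path_label M l q)
    (dfs M l out G r \<lparr>visited = {}, mval = (\<lambda>_. \<one>)\<rparr>)"
proof -
  let ?s = "\<lparr>visited = {}, mval = (\<lambda>_. \<one>)\<rparr>"
  have "values_realized r (?s\<lparr>visited := insert r (visited ?s)\<rparr>)"
    using assms(2) by (auto simp: values_realized_def awalk_Nil_iff intro: exI[of _ "[]"])
  from dfs_spec[OF assms(1,3) _ this] show ?thesis
  proof (rule ends_with_mono)
    fix s
    assume s: "extends (?s\<lparr>visited := insert r (visited ?s)\<rparr>) s \<and> values_realized r s \<and>
       (\<forall>w\<in>visited s - visited ?s. \<forall>e\<in>out_arcs G w. consistent s e)"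
    then have r: "r \<in> visited s" "mval s r = \<one>" by (auto simp: extends_def)
    have "path_label M l p = mval s w" if "awalk r p w" for p w
      using walk_label_eq_mval[OF _ that r(1)] r(2) s awalk_label_closed[OF that] by simp
    then show "\<forall>w p q. awalk r p w \<and> awalk r q w \<longrightarrow> path_label M l p = path_label M l q"
      by metis
  qed simp_all
qed

lemma search_from_all_roots_spec:
  assumes "finite (verts G)" "set (roots ord) = verts G"
    and "\<And>r v. r \<in> verts G \<Longrightarrow> v \<in> verts G \<Longrightarrow>
      set (remaining G (es_dfs ord r v)) = out_arcs G v"
  shows "ends_with (\<not> commutative_diagram M G l) (\<lambda>_. commutative_diagram M G l)
    (search_from_all_roots M l ord G)"
proof -
  define I where "I pre = (\<lambda>_ :: unit. \<forall>r\<in>set pre. \<forall>w p q. awalk r p w \<and> awalk r q w \<longrightarrow>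
      path_label M l p = path_label M l q)" for pre
  have "ends_with (\<not> commutative_diagram M G l) (I (roots ord))
    (search_from_all_roots M l ord G)"
    unfolding search_from_all_roots_def
  proof (rule ends_with_for_each)
    show "I [] ()" by (simp add: I_def)
  next
    fix pre r post and s :: unit
    assume "roots ord = pre @ r # post" and I: "I pre s"
    then have r: "r \<in> verts G" using assms(2) by auto
    show "ends_with (\<not> commutative_diagram M G l) (I (pre @ [r]))
      (dfs M l (es_dfs ord r) G r \<lparr>visited = {}, mval = \<lambda>_. \<one>\<rparr> \<then> (\<lambda>_. Some (Continue ())))"
      by (rule ends_with_and_then[OF dfs_from_root_spec[OF assms(1) r assms(3)[OF r]]])
        (use I in \<open>auto simp: I_def\<close>)
  qed
  then show ?thesis
  proof (rule ends_with_mono)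
    fix s assume "I (roots ord) s"
    then show "commutative_diagram M G l"
      unfolding commutative_diagram_def I_def assms(2) by (meson awalk_hd_in_verts)
  qed
qed

end


section \<open>Correctness of the algorithm\<close>

theorem mainTheorem5:
  fixes M :: "('m, 'x) monoid_scheme"
    and G :: "('v, 'e) pre_digraph"
    and l :: "'e \<Rightarrow> 'm"
    and ord :: "('v, 'e) loop_orders"
  assumes "monoid M"
    and "oriented_graph G"
    and "l \<in> arcs G \<rightarrow> carrier M"
    and "loop_orders_of G ord"
  shows "(core_algorithm M ord G l = Some (Exit True) \<longleftrightarrow> commutative_diagram M G l)
       \<and> (core_algorithm M ord G l = Some (Exit False) \<longleftrightarrow> \<not> commutative_diagram M G l)"
proof -
  interpret G: fin_digraph G
    using assms(2) by (simp add: oriented_graph_def)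
  interpret G: diagram G M l
    using assms(1,3) by (intro diagram.intro diagram_axioms.intro G.wf_digraph_axioms)
  let ?bad = "\<not> commutative_diagram M G l"
  have search: "ends_with ?bad (\<lambda>_. commutative_diagram M G l) (search_from_all_roots M l ord H)"
    if red: "reduces_to M l G H" for H
  proof -
    interpret H: diagram H M l using red by (rule G.reduces_to_diagram)
    have "ends_with (\<not> commutative_diagram M H l) (\<lambda>_. commutative_diagram M H l)
        (search_from_all_roots M l ord H)"
    proof (rule H.search_from_all_roots_spec)
      show "finite (verts H)" "set (roots ord) = verts H"
        using red assms(4)
        by (auto simp: reduces_to_def loop_orders_of_def permutations_of_set_def)
      fix r v
      assume "r \<in> verts H" "v \<in> verts H"
      then have "set (es_dfs ord r v) = out_arcs G v"
        using red assms(4)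
        by (auto simp: reduces_to_def loop_orders_of_def permutations_of_set_def)
      then show "set (remaining H (es_dfs ord r v)) = out_arcs H v"
        using red by (auto simp: reduces_to_def remaining_def)
    qed
    then show ?thesis by (simp add: reduces_to_commutative_iff[OF red])
  qed
  have "ends_with ?bad (\<lambda>_. commutative_diagram M G l)
      (remove_loops M l ord G \<then> remove_multiple_edges l ord \<then> search_from_all_roots M l ord)"
    using G.remove_loops_spec G.remove_multiple_edges_spec search assms(4)
    by (blast intro: ends_with_and_then)
  then show ?thesis
    unfolding core_algorithm_def ends_with_def
    by (elim disjE exE conjE) (simp_all add: and_then_def[of _ "\<lambda>_. Some (Exit True)"])
qed

end
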